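(* Consider the metrics $$\text{(C.8)}\quad g=\kappa\,(Y(y)+x)\,dx\,dy,\qquad Y(y)=\int^y\frac{e^{3/(2s)}}{|s|^{3/2}}\,ds,\qquad \kappa\in\mathbb{R}\setminus\{0\},$$ $$\text{(C.9a)}\quad g=e^{\lambda\theta}\,(Y_\lambda(y)+x)\,dx\,dy,\qquad \lambda>0,\ \theta\in[0,2\pi),$$ $$\text{(C.9b)}\quad g=\kappa\,(Y_0(y)+x)\,dx\,dy,\qquad \kappa>0,$$ where $$Y_\lambda(y)=\int^y\frac{e^{-\frac{3\lambda}{2}\arctan(s)}}{\sqrt[4]{s^2+1}}\,ds .$$ These normal forms can, almost everywhere on their domain, be expressed in terms of hypergeometric functions: near almost every point, up to isometry, the unevaluated integral $Y$, respectively $Y_\lambda$, can be replaced by a function given explicitly in terms of hypergeometric functions.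
   Context: The integrals $\int^y$ denote an antiderivative, whose integration constant may be chosen freely (it can be absorbed by a translation of $x$). "Isometry" means a local change of coordinates. "Expressed in terms of hypergeometric functions" means given by a closed expression built from elementary functions and (generalized, possibly confluent) hypergeometric functions ${}_pF_q$, whose parameters and arguments may be complex. *)

theory Defs
  imports "HOL-Analysis.Analysis" "HOL-Library.Nonpos_Ints"
begin

(* The pFq-series at z for p \<le> q, or p = q + 1 and norm z < 1.  For p = q + 1 it is continued
   to the principal branch on the plane cut along [1, \<infinity>); the continuation is unique because
   the cut plane is connected. *)
definition hypergeo :: "complex list \<Rightarrow> complex list \<Rightarrow> complex \<Rightarrow> complex" where
  "hypergeo as bs z =
     (if length as \<le> length bs \<or> norm z < 1 then eval_fps (fps_hypergeo as bs 1) z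
      else (THE w. \<exists>f. f holomorphic_on (- complex_of_real ` {1..}) \<and>
                       (\<forall>t\<in>ball 0 1. f t = eval_fps (fps_hypergeo as bs 1) t) \<and> f z = w))"

definition hypergeo_domain :: "complex list \<Rightarrow> complex list \<Rightarrow> complex set" where
  "hypergeo_domain as bs =
     {z. set bs \<inter> \<int>\<^sub>\<le>\<^sub>0 = {} \<and>
         (length as \<le> length bs \<or>
          length as = Suc (length bs) \<and> z \<notin> complex_of_real ` {1..})}"

(* Functions of one real variable that are given on all of S by a single closed expression.
   Roots, powers and trigonometric functions are obtained from exp and Ln with complex
   constants.  The side conditions say that the expression is defined throughout S. *)
inductive hypergeo_closed_form :: "real set \<Rightarrow> (real \<Rightarrow> complex) \<Rightarrow> bool" for S where
  const: "hypergeo_closed_form S (\<lambda>_. c)"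
| var: "hypergeo_closed_form S complex_of_real"
| add: "hypergeo_closed_form S f \<Longrightarrow> hypergeo_closed_form S g \<Longrightarrow>
    hypergeo_closed_form S (\<lambda>y. f y + g y)"
| mult: "hypergeo_closed_form S f \<Longrightarrow> hypergeo_closed_form S g \<Longrightarrow>
    hypergeo_closed_form S (\<lambda>y. f y * g y)"
| inverse: "hypergeo_closed_form S f \<Longrightarrow> (\<And>y. y \<in> S \<Longrightarrow> f y \<noteq> 0) \<Longrightarrow>
    hypergeo_closed_form S (\<lambda>y. inverse (f y))"
| exp: "hypergeo_closed_form S f \<Longrightarrow> hypergeo_closed_form S (\<lambda>y. exp (f y))"
| Ln: "hypergeo_closed_form S f \<Longrightarrow> (\<And>y. y \<in> S \<Longrightarrow> f y \<noteq> 0) \<Longrightarrow>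
    hypergeo_closed_form S (\<lambda>y. Ln (f y))"
| hypergeo: "hypergeo_closed_form S f \<Longrightarrow> (\<And>y. y \<in> S \<Longrightarrow> f y \<in> hypergeo_domain as bs) \<Longrightarrow>
    hypergeo_closed_form S (\<lambda>y. hypergeo as bs (f y))"
| cong: "hypergeo_closed_form S f \<Longrightarrow> (\<And>y. y \<in> S \<Longrightarrow> g y = f y) \<Longrightarrow>
    hypergeo_closed_form S g"

(* Intended for open U.  In finite dimension, directional derivatives of all orders suffice. *)
primrec k_times_differentiable_on ::
  "nat \<Rightarrow> ('a::real_normed_vector \<Rightarrow> 'b::real_normed_vector) \<Rightarrow> 'a set \<Rightarrow> bool" where
  "k_times_differentiable_on 0 f U \<longleftrightarrow> continuous_on U f"
| "k_times_differentiable_on (Suc k) f U \<longleftrightarrow>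
     (\<forall>p\<in>U. f differentiable (at p)) \<and>
     (\<forall>v. k_times_differentiable_on k (\<lambda>p. frechet_derivative f (at p) v) U)"

definition smooth_on ::
  "'a::real_normed_vector set \<Rightarrow> ('a \<Rightarrow> 'b::real_normed_vector) \<Rightarrow> bool" where
  "smooth_on U f \<longleftrightarrow> (\<forall>k. k_times_differentiable_on k f U)"

(* A field of bilinear forms on the (x, y)-plane: base point, then two tangent vectors. *)
type_synonym metric = "real \<times> real \<Rightarrow> real \<times> real \<Rightarrow> real \<times> real \<Rightarrow> real"

definition isometry_between ::
  "(real \<times> real) set \<Rightarrow> metric \<Rightarrow> (real \<times> real) set \<Rightarrow> metric \<Rightarrow>
   (real \<times> real \<Rightarrow> real \<times> real) \<Rightarrow> bool" where
  "isometry_between U g V h \<phi> \<longleftrightarrow>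
     open U \<and> open V \<and> bij_betw \<phi> U V \<and>
     smooth_on U \<phi> \<and> smooth_on V (the_inv_into U \<phi>) \<and>
     (\<forall>p\<in>U. \<forall>u v. h (\<phi> p) (frechet_derivative \<phi> (at p) u) (frechet_derivative \<phi> (at p) v)
                    = g p u v)"

(* c (Y(y) + x) dx dy, where dx dy is the symmetric product *)
definition normal_form :: "real \<Rightarrow> (real \<Rightarrow> real) \<Rightarrow> metric" where
  "normal_form c Y = (\<lambda>(x, y) u v. c * (Y y + x) * ((fst u * snd v + snd u * fst v) / 2))"

(* D is the domain of the antiderivative Y; the form degenerates where Y(y) + x = 0. *)
definition normal_form_domain :: "real set \<Rightarrow> (real \<Rightarrow> real) \<Rightarrow> (real \<times> real) set" where
  "normal_form_domain D Y = {(x, y). y \<in> D \<and> Y y + x \<noteq> 0}"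

definition antiderivative_on :: "real set \<Rightarrow> (real \<Rightarrow> real) \<Rightarrow> (real \<Rightarrow> real) \<Rightarrow> bool" where
  "antiderivative_on D f Y \<longleftrightarrow> (\<forall>y\<in>D. (Y has_real_derivative f y) (at y))"

definition ae_hypergeo_expressible :: "real \<Rightarrow> real set \<Rightarrow> (real \<Rightarrow> real) \<Rightarrow> bool" where
  "ae_hypergeo_expressible c D Y \<longleftrightarrow>
     (AE p in lebesgue. p \<in> normal_form_domain D Y \<longrightarrow>
        (\<exists>U V \<phi> F. p \<in> U \<and> U \<subseteq> normal_form_domain D Y \<and>
           isometry_between U (normal_form c Y) V (normal_form c F) \<phi> \<and>
           hypergeo_closed_form (snd ` V) (\<lambda>y. complex_of_real (F y))))"

definition exp_integrand :: "real \<Rightarrow> real" where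
  "exp_integrand s = exp (3 / (2 * s)) / \<bar>s\<bar> powr (3 / 2)"

definition arctan_integrand :: "real \<Rightarrow> real \<Rightarrow> real" where
  "arctan_integrand lam s = exp (- (3 * lam / 2) * arctan s) / root 4 (s\<^sup>2 + 1)"

end

theory Submission
  imports Defs
begin

text \<open>
  Only the function \<open>Y\<close> has to be treated, and no change of coordinates is needed: if \<open>Y\<close> itself is
  a closed form on an open interval around \<open>y\<close>, then the identity is the isometry near \<open>(x, y)\<close>.

  Both integrals are of the type \<open>\<integral> z\<^sup>c\<^sup>-\<^sup>1 G(z) dz\<close>, where \<open>G\<close> is the exponential function, which is
  \<open>0F0\<close>, or a binomial \<open>(1 - z) powr (- b)\<close>, which is \<open>1F0\<close> with parameter \<open>b\<close>.  Integrating the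
  series of \<open>G\<close> term by term inserts the factors \<open>c / (c + k)\<close>, which are the ratios of the
  Pochhammer symbols of \<open>c\<close> and \<open>c + 1\<close>; so the result is again hypergeometric, with the extra
  upper parameter \<open>c\<close> and the extra lower parameter \<open>c + 1\<close>
  (\<open>hypergeo_parameter_raise\<close>, \<open>has_vector_derivative_exp_times_hypergeo\<close>).

  The exponential integral takes this form with \<open>c = 1/2\<close> and \<open>z = 3 / (2 y)\<close>, on either side of
  the origin.  For the arctangent integral put \<open>w = (1 + i s) / 2\<close> and \<open>a = 3 \<lambda> / 2\<close>.  Up to a
  constant the integrand is \<open>w powr \<alpha> * (1 - w) powr \<beta>\<close> with
  \<open>\<alpha> = - 1/4 + i a / 2\<close> and \<open>\<beta> = - 1/4 - i a / 2\<close>.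
  Where \<open>\<bar>w\<bar> < 1\<close> this is the above type with \<open>z = w\<close>, \<open>c = \<alpha> + 1\<close>; where
  \<open>\<bar>w\<bar> > 1\<close> it is so with \<open>z = 1 / w\<close>, \<open>c = - 1 - \<alpha> - \<beta> = - 1/2\<close>.  In both cases \<open>\<bar>z\<bar> < 1\<close>, so the
  defining power series suffices.  What remains is \<open>\<bar>w\<bar> = 1\<close>, that is \<open>s = \<plusminus> sqrt 3\<close>: two lines in
  the plane, hence a null set.

  The constant in the arctangent integrand, which involves branches of complex powers, is never
  computed: two nonvanishing functions with the same logarithmic derivative on an interval are
  proportional.
\<close>

section \<open>Reduction to a closed form of the antiderivative\<close>

lemma smooth_on_cong:
  assumes U: "open U" and eq: "\<And>p. p \<in> U \<Longrightarrow> f p = g p" and f: "smooth_on U f"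
  shows "smooth_on U g"
  unfolding smooth_on_def
proof
  fix k
  have "k_times_differentiable_on k f U"
    using f by (simp add: smooth_on_def)
  with eq show "k_times_differentiable_on k g U"
  proof (induction k arbitrary: f g)
    case 0
    have "continuous_on U g"
      by (rule continuous_on_eq[of U f]) (use 0 in simp_all)
    then show ?case by simp
  next
    case (Suc k)
    have f: "(f has_derivative frechet_derivative f (at p)) (at p)" if "p \<in> U" for p
      using Suc.prems(2) that by (simp add: frechet_derivative_works)
    have g: "(g has_derivative frechet_derivative f (at p)) (at p)" if "p \<in> U" for p
      by (rule has_derivative_transform_within_open[OF f[OF that] U that Suc.prems(1)])
    have "g differentiable at p" if "p \<in> U" for p
      using g[OF that] by (rule differentiableI)
    moreover have "k_times_differentiable_on k (\<lambda>p. frechet_derivative g (at p) v) U" for v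
    proof (rule Suc.IH)
      show "frechet_derivative f (at p) v = frechet_derivative g (at p) v" if "p \<in> U" for p
        using frechet_derivative_at[OF g[OF that]] by (rule fun_cong)
      show "k_times_differentiable_on k (\<lambda>p. frechet_derivative f (at p) v) U"
        using Suc.prems(2) by simp
    qed
    ultimately show ?case by simp
  qed
qed

lemma smooth_on_ident: "smooth_on U (\<lambda>p. p)"
proof -
  have const: "k_times_differentiable_on k (\<lambda>_. c) U" for k c
    by (induction k arbitrary: c) auto
  have "k_times_differentiable_on k (\<lambda>p. p) U" for k
    by (cases k) (auto simp: const)
  then show ?thesis by (simp add: smooth_on_def)
qed

text \<open>
  The inverse of the identity as given by \<open>the_inv_into\<close> is unspecified outside \<open>U\<close>, so its
  smoothness has to be transferred from the identity on the open set \<open>U\<close>.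
\<close>

lemma isometry_between_ident:
  assumes "open U"
  shows "isometry_between U g U g (\<lambda>p. p)"
proof -
  have "p = the_inv_into U (\<lambda>p. p) p" if "p \<in> U" for p
    using the_inv_into_f_f[of "\<lambda>p. p" U p] that by auto
  then have "smooth_on U (the_inv_into U (\<lambda>p. p))"
    using smooth_on_cong[OF assms _ smooth_on_ident] by blast
  then show ?thesis
    using assms smooth_on_ident by (simp add: isometry_between_def bij_betw_def)
qed

lemma open_nondegenerate_strip:
  fixes Y :: "real \<Rightarrow> real"
  assumes "open I" "continuous_on I Y"
  shows "open {(x, y). y \<in> I \<and> Y y + x \<noteq> 0}"
proof -
  have "continuous_on (UNIV \<times> I) (\<lambda>p. Y (snd p) + fst p)"
    by (intro continuous_intros continuous_on_compose2[OF assms(2)]) auto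
  then have "open ((UNIV \<times> I) \<inter> (\<lambda>p. Y (snd p) + fst p) -` (- {0}))"
    by (rule continuous_open_preimage) (auto simp: assms open_Times)
  moreover have "(UNIV \<times> I) \<inter> (\<lambda>p. Y (snd p) + fst p) -` (- {0}) =
      {(x, y). y \<in> I \<and> Y y + x \<noteq> 0}"
    by auto
  ultimately show ?thesis by simp
qed

text \<open>
  Finitely many exceptional values of \<open>y\<close> exclude finitely many horizontal lines, which form a
  null set.
\<close>

lemma ae_hypergeo_expressibleI:
  assumes Y: "antiderivative_on D f Y" and N: "finite N"
    and cf: "\<And>y. y \<in> D - N \<Longrightarrow> \<exists>I. open I \<and> y \<in> I \<and> I \<subseteq> D \<and>
               hypergeo_closed_form I (\<lambda>y. complex_of_real (Y y))"
  shows "ae_hypergeo_expressible c D Y"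
  unfolding ae_hypergeo_expressible_def
proof (rule AE_I')
  have "negligible {p :: real \<times> real. snd p = y}" for y
    using negligible_standard_hyperplane[of "(0, 1) :: real \<times> real" y]
    by (simp add: Basis_prod_def inner_prod_def)
  then have "negligible (\<Union>y\<in>N. {p :: real \<times> real. snd p = y})"
    using N by (intro negligible_Union) auto
  then show "(\<Union>y\<in>N. {p :: real \<times> real. snd p = y}) \<in> null_sets lebesgue"
    by (simp add: negligible_iff_null_sets)
next
  have "\<exists>U V \<phi> F. p \<in> U \<and> U \<subseteq> normal_form_domain D Y \<and>
           isometry_between U (normal_form c Y) V (normal_form c F) \<phi> \<and>
           hypergeo_closed_form (snd ` V) (\<lambda>y. complex_of_real (F y))"
    if p: "p \<in> normal_form_domain D Y" "snd p \<notin> N" for p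
  proof -
    have "snd p \<in> D - N"
      using p by (simp add: normal_form_domain_def split: prod.splits)
    from cf[OF this] obtain I where I: "open I" "snd p \<in> I" "I \<subseteq> D"
      "hypergeo_closed_form I (\<lambda>y. complex_of_real (Y y))"
      by blast
    define U where "U = {(x, y). y \<in> I \<and> Y y + x \<noteq> 0}"
    have "continuous_on I Y"
      using Y I(3) unfolding antiderivative_on_def
      by (intro continuous_at_imp_continuous_on) (blast intro: DERIV_isCont)
    then have "open U" unfolding U_def by (rule open_nondegenerate_strip[OF I(1)])
    then have "isometry_between U (normal_form c Y) U (normal_form c Y) (\<lambda>p. p)"
      by (rule isometry_between_ident)
    moreover have "snd ` U = I"
    proof
      have "(1 - Y y, y) \<in> U" if "y \<in> I" for y using that by (simp add: U_def)
      then show "I \<subseteq> snd ` U" by force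
    qed (auto simp: U_def)
    moreover have "p \<in> U" "U \<subseteq> normal_form_domain D Y"
      using p I by (auto simp: U_def normal_form_domain_def)
    ultimately show ?thesis using I(4) by metis
  qed
  then show "{p \<in> space lebesgue. \<not> (p \<in> normal_form_domain D Y \<longrightarrow>
      (\<exists>U V \<phi> F. p \<in> U \<and> U \<subseteq> normal_form_domain D Y \<and>
           isometry_between U (normal_form c Y) V (normal_form c F) \<phi> \<and>
           hypergeo_closed_form (snd ` V) (\<lambda>y. complex_of_real (F y))))}
      \<subseteq> (\<Union>y\<in>N. {p. snd p = y})"
    by blast
qed

section \<open>Raising a pair of parameters\<close>

lemma foldl_mult_const:
  fixes v :: "'a::comm_ring_1"
  shows "foldl (\<lambda>r x. r * f x) v xs = v * foldl (\<lambda>r x. r * f x) 1 xs"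
  using foldl_mult_start[of f 1 xs v] by (simp add: mult.commute)

lemma plus_nat_nonzero:
  fixes c :: complex
  assumes "c + 1 \<notin> \<int>\<^sub>\<le>\<^sub>0" "n > 0"
  shows "c + of_nat n \<noteq> 0"
proof
  assume "c + of_nat n = 0"
  then have "c + 1 = - of_nat (n - 1)"
    using assms(2) by (simp add: of_nat_diff eq_neg_iff_add_eq_0 algebra_simps)
  with assms(1) show False by simp
qed

lemma pochhammer_shift:
  fixes c :: complex
  shows "(c + of_nat n) * pochhammer c n = c * pochhammer (c + 1) n"
  using pochhammer_rec[of c n] pochhammer_Suc[of c n] by (simp add: mult.commute)

lemma fps_hypergeo_parameter_raise_nth:
  fixes c :: complex
  assumes c: "c + 1 \<notin> \<int>\<^sub>\<le>\<^sub>0"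
  shows "(c + of_nat n) * fps_nth (fps_hypergeo (c # as) ((c + 1) # bs) 1) n =
         c * fps_nth (fps_hypergeo as bs 1) n"
proof -
  have nz: "pochhammer (c + 1) n \<noteq> 0"
    using c pochhammer_eq_0_imp_nonpos_Int by blast
  have "(c + of_nat n) * fps_nth (fps_hypergeo (c # as) ((c + 1) # bs) 1) n =
      ((c + of_nat n) * pochhammer c n) / pochhammer (c + 1) n * fps_nth (fps_hypergeo as bs 1) n"
    by (simp add: foldl_mult_const[of _ "pochhammer c n"] foldl_mult_const[of _ "pochhammer (c+1) n"]
        mult.assoc)
  then show ?thesis
    using nz by (simp only: pochhammer_shift) simp
qed

text \<open>Since \<open>\<bar>c\<bar> \<le> \<bar>c + n\<bar>\<close> for large \<open>n\<close>, the coefficients of the raised series are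
  eventually dominated by those of the original one.\<close>

lemma fps_conv_radius_hypergeo_parameter_raise:
  fixes c :: complex
  assumes c: "c + 1 \<notin> \<int>\<^sub>\<le>\<^sub>0"
  shows "fps_conv_radius (fps_hypergeo as bs (1::complex)) \<le>
         fps_conv_radius (fps_hypergeo (c # as) ((c + 1) # bs) 1)"
proof -
  let ?F = "fps_hypergeo (c # as) ((c + 1) # bs) (1::complex)" and ?G = "fps_hypergeo as bs (1::complex)"
  have "summable (\<lambda>n. fps_nth ?F n * of_real r ^ n)"
    if r: "0 < r" "ereal r < fps_conv_radius ?G" for r
  proof (rule summable_comparison_test_ev)
    show "summable (\<lambda>n. norm (fps_nth ?G n * of_real r ^ n))"
      using r by (intro abs_summable_in_conv_radius) (simp add: fps_conv_radius_def)
    have shrink: "norm (fps_nth ?F n * of_real r ^ n) \<le> norm (fps_nth ?G n * of_real r ^ n)"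
      if n: "n \<ge> nat \<lceil>2 * norm c\<rceil>" "n > 0" for n
    proof -
      have "norm c \<le> norm (c + of_nat n)"
        using norm_triangle_ineq4[of "c + of_nat n" c] n(1) by simp
      moreover have "norm (c + of_nat n) * norm (fps_nth ?F n) = norm c * norm (fps_nth ?G n)"
        using fps_hypergeo_parameter_raise_nth[OF c] by (metis norm_mult)
      ultimately have "norm (c + of_nat n) * norm (fps_nth ?F n) \<le> norm (c + of_nat n) * norm (fps_nth ?G n)"
        by (metis mult_right_mono norm_ge_zero)
      then have "norm (fps_nth ?F n) \<le> norm (fps_nth ?G n)"
        using plus_nat_nonzero[OF c n(2)] by (simp del: fps_hypergeo_nth)
      then show ?thesis by (simp add: norm_mult mult_right_mono del: fps_hypergeo_nth)
    qed
    show "\<forall>\<^sub>F n in sequentially.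
        norm (fps_nth ?F n * of_real r ^ n) \<le> norm (fps_nth ?G n * of_real r ^ n)"
      using eventually_ge_at_top[of "nat \<lceil>2 * norm c\<rceil>"] eventually_gt_at_top[of 0]
      by eventually_elim (rule shrink)
  qed
  then show ?thesis
    unfolding fps_conv_radius_def by (intro conv_radius_geI_ex') auto
qed

text \<open>
  The Euler operator \<open>z d/dz + c\<close> multiplies the \<open>n\<close>-th coefficient by \<open>c + n\<close>, so it undoes
  the raising of the parameters.
\<close>

lemma hypergeo_parameter_raise:
  fixes c z :: complex
  assumes c: "c + 1 \<notin> \<int>\<^sub>\<le>\<^sub>0"
    and z: "norm z < fps_conv_radius (fps_hypergeo as bs (1::complex))"
  defines "F \<equiv> fps_hypergeo (c # as) ((c + 1) # bs) 1"
  shows "z * eval_fps (fps_deriv F) z + c * eval_fps F z = c * eval_fps (fps_hypergeo as bs 1) z"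
proof -
  let ?G = "fps_hypergeo as bs (1::complex)"
  have zF: "norm z < fps_conv_radius F"
    using less_le_trans[OF z fps_conv_radius_hypergeo_parameter_raise[OF c]] by (simp add: F_def)
  have zF': "norm z < fps_conv_radius (fps_deriv F)"
    using less_le_trans[OF zF fps_conv_radius_deriv] .
  have zX: "norm z < fps_conv_radius (fps_X * fps_deriv F)"
    using zF' by (intro less_le_trans[OF _ fps_conv_radius_mult]) simp
  have zC: "norm z < fps_conv_radius (fps_const c * F)"
    using zF by (intro less_le_trans[OF _ fps_conv_radius_mult]) simp
  have eq: "fps_X * fps_deriv F + fps_const c * F = fps_const c * ?G"
  proof (rule fps_ext)
    fix n
    have "fps_nth (fps_X * fps_deriv F + fps_const c * F) n = (c + of_nat n) * fps_nth F n"
      by (cases n) (simp_all add: algebra_simps del: fps_hypergeo_nth)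
    also have "\<dots> = c * fps_nth ?G n"
      unfolding F_def by (rule fps_hypergeo_parameter_raise_nth[OF c])
    finally show "fps_nth (fps_X * fps_deriv F + fps_const c * F) n = fps_nth (fps_const c * ?G) n"
      by simp
  qed
  have "z * eval_fps (fps_deriv F) z + c * eval_fps F z
      = eval_fps (fps_X * fps_deriv F + fps_const c * F) z"
    using zF zF' zX zC by (simp add: eval_fps_add eval_fps_mult)
  also have "\<dots> = c * eval_fps ?G z"
    using z by (simp add: eq eval_fps_mult)
  finally show ?thesis .
qed

text \<open>
  Here \<open>exp q\<close> is a branch of \<open>z\<^sup>c\<close>; it enters through its logarithmic derivative alone, so that
  \<open>z\<close> may run along the cut of the principal branch.
\<close>

lemma has_vector_derivative_exp_times_hypergeo:
  fixes q z :: "real \<Rightarrow> complex"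
  assumes c: "c + 1 \<notin> \<int>\<^sub>\<le>\<^sub>0"
    and z: "(z has_vector_derivative z') (at y)" "z y \<noteq> 0"
    and q: "(q has_vector_derivative c * (z' / z y)) (at y)"
    and radius: "norm (z y) < fps_conv_radius (fps_hypergeo as bs (1::complex))"
  shows "((\<lambda>y. exp (q y) * eval_fps (fps_hypergeo (c # as) ((c + 1) # bs) 1) (z y))
           has_vector_derivative
           exp (q y) * c * (z' / z y) * eval_fps (fps_hypergeo as bs 1) (z y)) (at y)"
proof -
  let ?F = "fps_hypergeo (c # as) ((c + 1) # bs) (1::complex)"
  let ?G = "fps_hypergeo as bs (1::complex)"
  have zF: "norm (z y) < fps_conv_radius ?F"
    using less_le_trans[OF radius fps_conv_radius_hypergeo_parameter_raise[OF c]] .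
  have 1: "((\<lambda>y. exp (q y)) has_vector_derivative (c * (z' / z y)) * exp (q y)) (at y)"
    using field_vector_diff_chain_at[OF q DERIV_exp] by (simp add: o_def)
  have 2: "((\<lambda>y. eval_fps ?F (z y)) has_vector_derivative z' * eval_fps (fps_deriv ?F) (z y)) (at y)"
    using field_vector_diff_chain_at[OF z(1) has_field_derivative_eval_fps[OF zF]]
    by (simp add: o_def)
  have 3: "c * eval_fps ?G (z y) = z y * eval_fps (fps_deriv ?F) (z y) + c * eval_fps ?F (z y)"
    using hypergeo_parameter_raise[OF c radius] by simp
  have "exp (q y) * c * (z' / z y) * eval_fps ?G (z y)
      = exp (q y) * (z' / z y) * (c * eval_fps ?G (z y))"
    by simp
  also have "\<dots> = exp (q y) * (z' * eval_fps (fps_deriv ?F) (z y))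
      + (c * (z' / z y)) * exp (q y) * eval_fps ?F (z y)"
    unfolding 3 using z(2) by (simp add: field_simps)
  finally show ?thesis
    using has_vector_derivative_mult[OF 1 2] by simp
qed

lemma fps_hypergeo_binomial_nth:
  "fps_nth (fps_hypergeo [b] [] (1::complex)) n = (- b gchoose n) * (- 1) ^ n"
proof -
  have "(- 1) ^ n * (- 1) ^ n = (1::complex)"
    by (simp flip: power_mult_distrib)
  then show ?thesis
    by (simp add: gbinomial_pochhammer)
qed

lemma sums_fps_hypergeo_binomial:
  fixes b z :: complex
  assumes "norm z < 1"
  shows "(\<lambda>n. fps_nth (fps_hypergeo [b] [] 1) n * z ^ n) sums ((1 - z) powr (- b))"
proof -
  have *: "fps_nth (fps_hypergeo [b] [] 1) n * z ^ n = (- b gchoose n) * (- z) ^ n" for n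
    by (simp only: fps_hypergeo_binomial_nth power_minus[of z n] mult.assoc)
  show ?thesis
    unfolding * using gen_binomial_complex[of "- z" "- b"] assms by simp
qed

lemma eval_fps_hypergeo_binomial:
  fixes b z :: complex
  assumes "norm z < 1"
  shows "eval_fps (fps_hypergeo [b] [] 1) z = (1 - z) powr (- b)"
  unfolding eval_fps_def using sums_fps_hypergeo_binomial[OF assms] by (rule sums_unique[symmetric])

lemma fps_conv_radius_hypergeo_binomial:
  "fps_conv_radius (fps_hypergeo [b] [] (1::complex)) \<ge> 1"
  unfolding fps_conv_radius_def
proof (rule conv_radius_geI_ex')
  fix r :: real assume "0 < r" "ereal r < 1"
  then have "norm (complex_of_real r) < 1" by simp
  then show "summable (\<lambda>n. fps_nth (fps_hypergeo [b] [] (1::complex)) n * of_real r ^ n)"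
    using sums_fps_hypergeo_binomial sums_summable by blast
qed

section \<open>Closed forms from derivatives\<close>

lemma equal_vector_derivatives_differ_by_constant:
  fixes f g :: "real \<Rightarrow> 'a::real_normed_vector"
  assumes "open I" "connected I"
    and f: "\<And>y. y \<in> I \<Longrightarrow> (f has_vector_derivative f' y) (at y)"
    and g: "\<And>y. y \<in> I \<Longrightarrow> (g has_vector_derivative f' y) (at y)"
  obtains C where "\<And>y. y \<in> I \<Longrightarrow> f y = g y + C"
proof -
  have "convex I" using assms(2) is_interval_connected_1 is_interval_convex_1 by blast
  moreover have "((\<lambda>y. f y - g y) has_vector_derivative 0) (at y within I)" if "y \<in> I" for y
    using has_vector_derivative_diff[OF f[OF that] g[OF that]]
    by (simp add: has_vector_derivative_at_within)
  ultimately obtain C where "\<And>y. y \<in> I \<Longrightarrow> f y - g y = C"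
    using has_vector_derivative_zero_constant[of I "\<lambda>y. f y - g y"] by blast
  then have "f y = g y + C" if "y \<in> I" for y
    using that by (metis add.commute diff_add_cancel)
  then show thesis using that by blast
qed

lemma hypergeo_closed_form_of_derivative:
  assumes I: "open I" "connected I"
    and H: "hypergeo_closed_form I H"
    and H': "\<And>y. y \<in> I \<Longrightarrow> (H has_vector_derivative H' y) (at y)"
    and f: "\<And>y. y \<in> I \<Longrightarrow> complex_of_real (f y) = K * H' y"
    and Y: "antiderivative_on I f Y"
  shows "hypergeo_closed_form I (\<lambda>y. complex_of_real (Y y))"
proof -
  have "((\<lambda>y. complex_of_real (Y y)) has_vector_derivative K * H' y) (at y)" if "y \<in> I" for y
    using Y that f[OF that, symmetric]
    by (auto simp: antiderivative_on_def has_real_derivative_iff_has_vector_derivative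
        intro!: has_vector_derivative_of_real)
  moreover have "((\<lambda>y. K * H y) has_vector_derivative K * H' y) (at y)" if "y \<in> I" for y
    using has_vector_derivative_mult_right[OF H'[OF that]] .
  ultimately obtain C where C: "\<And>y. y \<in> I \<Longrightarrow> complex_of_real (Y y) = K * H y + C"
    using equal_vector_derivatives_differ_by_constant[OF I,
        of "\<lambda>y. complex_of_real (Y y)" "\<lambda>y. K * H' y" "\<lambda>y. K * H y"] by blast
  show ?thesis
    by (rule hypergeo_closed_form.cong[OF _ C])
      (intro hypergeo_closed_form.const hypergeo_closed_form.add hypergeo_closed_form.mult H)+
qed

lemma closed_form_divide:
  assumes "hypergeo_closed_form S f" "hypergeo_closed_form S g" "\<And>y. y \<in> S \<Longrightarrow> g y \<noteq> 0"
  shows "hypergeo_closed_form S (\<lambda>y. f y / g y)"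
  unfolding divide_inverse using assms by (intro hypergeo_closed_form.mult hypergeo_closed_form.inverse)

text \<open>The congruence rule stays out, because it applies to every goal, its own premise included.\<close>

lemmas closed_form_intros =
  hypergeo_closed_form.const hypergeo_closed_form.var hypergeo_closed_form.add
  hypergeo_closed_form.mult hypergeo_closed_form.inverse hypergeo_closed_form.exp
  hypergeo_closed_form.Ln hypergeo_closed_form.hypergeo closed_form_divide

text \<open>For \<open>2F1\<close> only the open unit disc is treated; there no continuation is involved.\<close>

lemma closed_form_exp_times_hypergeo_series:
  assumes q: "hypergeo_closed_form S q" and z: "hypergeo_closed_form S z"
    and c: "c + 1 \<notin> \<int>\<^sub>\<le>\<^sub>0"
    and as: "as = [] \<or> (length as = 1 \<and> (\<forall>y\<in>S. norm (z y) < 1))"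
  shows "hypergeo_closed_form S
           (\<lambda>y. exp (q y) * eval_fps (fps_hypergeo (c # as) [c + 1] 1) (z y))"
proof -
  have "z y \<in> hypergeo_domain (c # as) [c + 1]" if "y \<in> S" for y
    using as c that by (auto simp: hypergeo_domain_def)
  then have "hypergeo_closed_form S (\<lambda>y. exp (q y) * hypergeo (c # as) [c + 1] (z y))"
    by (intro closed_form_intros q z)
  then show ?thesis
    by (rule hypergeo_closed_form.cong) (use as in \<open>auto simp: hypergeo_def\<close>)
qed

section \<open>The exponential integral\<close>

text \<open>
  Up to a constant, \<open>\<bar>y\<bar> powr (- 1/2)\<close> is a branch of \<open>z\<^sup>1\<^sup>/\<^sup>2\<close> on either side of the origin, real
  even where \<open>z\<close> is negative.  Writing \<open>\<bar>y\<bar> = sg * y\<close> treats both sides at once.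
\<close>

lemma closed_form_exp_antiderivative:
  assumes sg: "sg = 1 \<or> sg = - 1"
    and I: "open I" "connected I" "\<And>y. y \<in> I \<Longrightarrow> sg * y > 0"
    and Y: "antiderivative_on I exp_integrand Y"
  shows "hypergeo_closed_form I (\<lambda>y. complex_of_real (Y y))"
proof -
  define q where "q = (\<lambda>y. complex_of_real (- ln (sg * y) / 2))"
  define z where "z = (\<lambda>y. complex_of_real (3 / (2 * y)))"
  define H where "H = (\<lambda>y. exp (q y) * eval_fps (fps_hypergeo [1/2] [1/2 + 1] 1) (z y))"
  define H' where "H' = (\<lambda>y. exp (q y) * (1/2) * (of_real (- 1 / y)) *
                              eval_fps (fps_hypergeo [] [] 1) (z y))"
  have c: "(1/2 + 1 :: complex) \<notin> \<int>\<^sub>\<le>\<^sub>0"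
    by (auto simp: complex_eq_iff elim!: nonpos_Ints_cases)
  have nz: "y \<noteq> 0" if "y \<in> I" for y using I(3)[OF that] by auto
  have "hypergeo_closed_form I (\<lambda>y. (- 1 / 2) * Ln (of_real sg * of_real y))"
    using nz sg by (intro closed_form_intros) auto
  then have q: "hypergeo_closed_form I q"
  proof (rule hypergeo_closed_form.cong)
    fix y assume "y \<in> I"
    then have "Ln (complex_of_real (sg * y)) = complex_of_real (ln (sg * y))"
      using I(3) by (intro Ln_of_real) auto
    then show "q y = (- 1 / 2) * Ln (of_real sg * of_real y)"
      by (simp add: q_def)
  qed
  have "hypergeo_closed_form I (\<lambda>y. 3 / (2 * complex_of_real y))"
    using nz by (intro closed_form_intros) auto
  then have z: "hypergeo_closed_form I z"
    by (rule hypergeo_closed_form.cong) (simp add: z_def)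
  have H: "hypergeo_closed_form I H"
    unfolding H_def by (intro closed_form_exp_times_hypergeo_series q z c) simp
  have der: "(H has_vector_derivative H' y) (at y)" if y: "y \<in> I" for y
  proof -
    have dz: "(z has_vector_derivative of_real (- 3 / (2 * y\<^sup>2))) (at y)"
      unfolding z_def
      by (intro has_vector_derivative_of_real)
        (use nz[OF y] in \<open>auto simp flip: has_real_derivative_iff_has_vector_derivative
          simp: power2_eq_square intro!: derivative_eq_intros\<close>)
    have ratio: "of_real (- 3 / (2 * y\<^sup>2)) / z y = complex_of_real (- 1 / y)"
      unfolding z_def of_real_divide[symmetric]
      using nz[OF y] by (simp add: power2_eq_square field_simps)
    have "(q has_vector_derivative of_real (- 1 / (2 * y))) (at y)"
      unfolding q_def
      by (intro has_vector_derivative_of_real)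
        (use nz[OF y] I(3)[OF y] sg in
          \<open>auto simp flip: has_real_derivative_iff_has_vector_derivative
          intro!: derivative_eq_intros\<close>)
    then have dq: "(q has_vector_derivative (1/2) * (of_real (- 3 / (2 * y\<^sup>2)) / z y)) (at y)"
      unfolding ratio by simp
    show ?thesis
      unfolding H_def H'_def ratio[symmetric]
      by (rule has_vector_derivative_exp_times_hypergeo[OF c dz _ dq])
        (use nz[OF y] in \<open>auto simp: z_def\<close>)
  qed
  (* the factor c * z' / z = - 1 / (2 * y) contributes - 1/2 and, through y = sg * \<bar>y\<bar>, the sign *)
  have "complex_of_real (exp_integrand y) = of_real (- 2 * sg) * H' y" if y: "y \<in> I" for y
  proof -
    have abs: "\<bar>y\<bar> = sg * y" "sg * sg = 1" using sg I(3)[OF y] by auto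
    have "exp (- ln (sg * y) / 2) = exp (- (3 / 2 * ln (sg * y))) * exp (ln (sg * y))"
      by (simp flip: exp_add)
    then have p: "exp (- ln (sg * y) / 2) = inverse ((sg * y) powr (3 / 2)) * (sg * y)"
      using I(3)[OF y] by (simp add: powr_def exp_minus)
    have cancel: "E / P = (- 2 * sg) * (inverse P * (sg * y) * (1 / 2) * (- 1 / y) * E)"
      for E P :: real
    proof -
      have "(- 2 * sg) * (inverse P * (sg * y) * (1 / 2) * (- 1 / y) * E) =
          (sg * sg) * (y / y) * (E * inverse P)"
        by simp
      also have "\<dots> = E / P"
        unfolding abs(2) divide_self[OF nz[OF y]] mult_1_left by (rule divide_inverse[symmetric])
      finally show ?thesis by (rule sym)
    qed
    have "exp_integrand y = (- 2 * sg) *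
        (exp (- ln (sg * y) / 2) * (1 / 2) * (- 1 / y) * exp (3 / (2 * y)))"
      unfolding exp_integrand_def abs(1) p by (rule cancel)
    then have "complex_of_real (exp_integrand y) = of_real ((- 2 * sg) *
        (exp (- ln (sg * y) / 2) * (1 / 2) * (- 1 / y) * exp (3 / (2 * y))))"
      by simp
    then show ?thesis
      unfolding H'_def q_def z_def by (simp flip: exp_of_real)
  qed
  then show ?thesis
    using hypergeo_closed_form_of_derivative[OF I(1,2) H der _ Y] by blast
qed

section \<open>The arctangent integral\<close>

text \<open>
  Treats \<open>z = w\<close> and \<open>z = 1 / w\<close> together, with \<open>\<epsilon> = 1\<close> and \<open>\<epsilon> = - 1\<close>, so that \<open>w powr (\<epsilon> c)\<close> is the
  required branch of \<open>z\<^sup>c\<close>.  Assumption \<open>log\<close> compares logarithmic derivatives: on the left that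
  of the derivative of the hypergeometric expression, on the right that of the integrand.
\<close>

lemma closed_form_arctan_antiderivative_unit_disc:
  fixes z z' :: "real \<Rightarrow> complex" and \<epsilon> c \<beta> :: complex
  defines "w \<equiv> \<lambda>y. (1 + \<i> * complex_of_real y) / 2"
  assumes I: "open I" "connected I"
    and Y: "antiderivative_on I (arctan_integrand lam) Y"
    and c: "c + 1 \<notin> \<int>\<^sub>\<le>\<^sub>0" "c \<noteq> 0" and \<epsilon>: "\<epsilon> \<noteq> 0"
    and z: "hypergeo_closed_form I z" "\<And>y. y \<in> I \<Longrightarrow> (z has_vector_derivative z' y) (at y)"
      "\<And>y. y \<in> I \<Longrightarrow> z y \<noteq> 0" "\<And>y. y \<in> I \<Longrightarrow> norm (z y) < 1"
    and ratio: "\<And>y. y \<in> I \<Longrightarrow> z' y / z y = \<epsilon> * (\<i> / 2 / w y)"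
    and log: "\<And>y. y \<in> I \<Longrightarrow> (\<epsilon> * c - 1) * (\<i> / 2 / w y) - \<beta> * (z' y / (1 - z y)) =
        of_real ((- (3 * lam / 2) - y / 2) / (1 + y\<^sup>2))"
  shows "hypergeo_closed_form I (\<lambda>y. complex_of_real (Y y))"
proof -
  define q where "q = (\<lambda>y. \<epsilon> * c * Ln (w y))"
  define H where "H = (\<lambda>y. exp (q y) * eval_fps (fps_hypergeo [c, - \<beta>] [c + 1] 1) (z y))"
  define H' where "H' = (\<lambda>y. exp (q y) * c * (z' y / z y) *
                              eval_fps (fps_hypergeo [- \<beta>] [] 1) (z y))"
  have wpos: "w y \<noteq> 0" "w y \<notin> \<real>\<^sub>\<le>\<^sub>0" for y
    by (auto simp: w_def complex_eq_iff complex_nonpos_Reals_iff)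
  have dLn: "((\<lambda>y. Ln (w y)) has_vector_derivative \<i> / 2 / w y) (at y)" for y
  proof -
    have "(w has_vector_derivative \<i> / 2) (at y)"
      unfolding w_def by (auto intro!: derivative_eq_intros)
    from field_vector_diff_chain_at[OF this has_field_derivative_Ln[OF wpos(2)]]
    show ?thesis by (simp add: o_def field_simps)
  qed
  have zpos: "1 - z y \<noteq> 0" "1 - z y \<notin> \<real>\<^sub>\<le>\<^sub>0" if y: "y \<in> I" for y
  proof -
    have "Re (z y) < 1" using complex_Re_le_cmod[of "z y"] z(4)[OF y] by simp
    then show "1 - z y \<noteq> 0" "1 - z y \<notin> \<real>\<^sub>\<le>\<^sub>0"
      by (auto simp: complex_eq_iff complex_nonpos_Reals_iff)
  qed
  have dLn1: "((\<lambda>y. Ln (1 - z y)) has_vector_derivative - (z' y / (1 - z y))) (at y)" if y: "y \<in> I" for y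
  proof -
    have "((\<lambda>y. 1 - z y) has_vector_derivative - z' y) (at y)"
      using has_vector_derivative_diff[OF has_vector_derivative_const[of 1] z(2)[OF y]] by simp
    from field_vector_diff_chain_at[OF this has_field_derivative_Ln[OF zpos(2)[OF y]]]
    show ?thesis by (simp add: o_def field_simps)
  qed
  have "hypergeo_closed_form I w"
    unfolding w_def by (intro closed_form_intros) auto
  then have q: "hypergeo_closed_form I q"
    unfolding q_def using wpos by (intro closed_form_intros) auto
  have H: "hypergeo_closed_form I H"
    unfolding H_def using z(4)
    by (intro closed_form_exp_times_hypergeo_series q z(1) c) auto
  have der: "(H has_vector_derivative H' y) (at y)" if y: "y \<in> I" for y
  proof -
    have "(q has_vector_derivative \<epsilon> * c * (\<i> / 2 / w y)) (at y)"
      unfolding q_def by (rule has_vector_derivative_mult_right[OF dLn])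
    then have dq: "(q has_vector_derivative c * (z' y / z y)) (at y)"
      by (simp only: ratio[OF y] mult_ac)
    show ?thesis
      unfolding H_def H'_def
      using z(4)[OF y]
      by (intro has_vector_derivative_exp_times_hypergeo c z y dq
          less_le_trans[OF _ fps_conv_radius_hypergeo_binomial]) simp
  qed
  define \<psi> where "\<psi> = (\<lambda>y. (\<epsilon> * c - 1) * Ln (w y) + \<beta> * Ln (1 - z y))"
  define \<phi> where "\<phi> = (\<lambda>y. complex_of_real (- (3 * lam / 2) * arctan y - ln (1 + y\<^sup>2) / 4))"
  define l where "l = (\<lambda>y. complex_of_real ((- (3 * lam / 2) - y / 2) / (1 + y\<^sup>2)))"
  have H'_exp: "H' y = \<epsilon> * c * (\<i> / 2) * exp (\<psi> y)" if y: "y \<in> I" for y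
  proof -
    have "exp (Ln (w y)) = w y" using wpos by simp
    then have "exp (q y) / w y = exp ((\<epsilon> * c - 1) * Ln (w y))"
      by (simp add: q_def left_diff_distrib exp_diff)
    moreover have "eval_fps (fps_hypergeo [- \<beta>] [] 1) (z y) = exp (\<beta> * Ln (1 - z y))"
      using eval_fps_hypergeo_binomial[OF z(4)[OF y], of "- \<beta>"] zpos[OF y] by (simp add: powr_def)
    moreover have "H' y = \<epsilon> * c * (\<i> / 2) * (exp (q y) / w y) *
        eval_fps (fps_hypergeo [- \<beta>] [] 1) (z y)"
      by (simp only: H'_def ratio[OF y]) (simp add: mult_ac)
    ultimately show ?thesis
      by (simp only: \<psi>_def exp_add mult.assoc)
  qed
  have integrand_exp: "complex_of_real (arctan_integrand lam y) = exp (\<phi> y)" for y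
  proof -
    have pos: "1 + y\<^sup>2 > 0" by (simp add: add_pos_nonneg)
    then have "root 4 (y\<^sup>2 + 1) = exp (ln (1 + y\<^sup>2) / 4)"
      by (simp add: root_powr_inverse powr_def add.commute)
    then show ?thesis
      by (simp add: arctan_integrand_def \<phi>_def exp_diff flip: exp_of_real)
  qed
  have "(\<phi> has_vector_derivative l y) (at y)" for y
  proof -
    have pos: "1 + y\<^sup>2 > 0" by (simp add: add_pos_nonneg)
    have common_denominator: "- A * inverse N - 1 / N * (2 * y) / 4 = (- A - y / 2) / N"
      if "N \<noteq> 0" for A N :: real
      using that by (simp add: field_simps)
    have "((\<lambda>y. 1 + y\<^sup>2) has_real_derivative 2 * y) (at y)"
      by (auto intro!: derivative_eq_intros)
    from DERIV_diff[OF DERIV_cmult[OF DERIV_arctan]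
        DERIV_cdivide[OF DERIV_chain2[OF DERIV_ln_divide[OF pos] this]]]
    have "((\<lambda>y. - (3 * lam / 2) * arctan y - ln (1 + y\<^sup>2) / 4) has_real_derivative
        - (3 * lam / 2) * inverse (1 + y\<^sup>2) - 1 / (1 + y\<^sup>2) * (2 * y) / 4) (at y)" .
    also have "- (3 * lam / 2) * inverse (1 + y\<^sup>2) - 1 / (1 + y\<^sup>2) * (2 * y) / 4 =
        (- (3 * lam / 2) - y / 2) / (1 + y\<^sup>2)"
      using pos by (intro common_denominator) simp
    finally show ?thesis
      unfolding \<phi>_def l_def
      by (rule has_vector_derivative_of_real)
  qed
  moreover have "(\<psi> has_vector_derivative l y) (at y)" if y: "y \<in> I" for y
    unfolding \<psi>_def l_def log[OF y, symmetric]
    using has_vector_derivative_add[OF has_vector_derivative_mult_right[OF dLn]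
        has_vector_derivative_mult_right[OF dLn1[OF y]]] by simp
  ultimately obtain C where C: "\<And>y. y \<in> I \<Longrightarrow> \<phi> y = \<psi> y + C"
    using equal_vector_derivatives_differ_by_constant[OF I, of \<phi> l \<psi>] by blast
  have "complex_of_real (arctan_integrand lam y) = exp C / (\<epsilon> * c * (\<i> / 2)) * H' y"
    if y: "y \<in> I" for y
  proof -
    have cancel: "e * C' = C' / k * (k * e)" if "k \<noteq> 0" for e C' k :: complex
      using that by simp
    show ?thesis
      unfolding integrand_exp H'_exp[OF y] C[OF y] exp_add
      by (rule cancel) (use c(2) \<epsilon> in simp)
  qed
  then show ?thesis
    using hypergeo_closed_form_of_derivative[OF I H der _ Y] by blast
qed

text \<open>
  The logarithmic derivative of \<open>w powr \<alpha> * (1 - w) powr \<beta>\<close> in terms of \<open>y\<close>; it is real because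
  \<open>\<beta>\<close> and \<open>1 - w\<close> are the complex conjugates of \<open>\<alpha>\<close> and \<open>w\<close>.
\<close>

lemma log_derivative_identity:
  fixes a y :: real
  shows "(- 1/4 + \<i> * of_real a / 2) * (\<i> / (1 + \<i> * of_real y)) -
         (- 1/4 - \<i> * of_real a / 2) * (\<i> / (1 - \<i> * of_real y)) =
         of_real ((- a - y / 2) / (1 + y\<^sup>2))"
proof -
  have nz: "1 + \<i> * of_real y \<noteq> 0" "1 - \<i> * of_real y \<noteq> 0"
    by (auto simp: complex_eq_iff)
  have common: "p * (\<i> / A) - q * (\<i> / B) = (p * \<i> * B - q * \<i> * A) / (A * B)"
    if "A \<noteq> 0" "B \<noteq> 0" for p q A B :: complex
    using that by (simp add: field_simps)
  have prod: "(1 + \<i> * of_real y) * (1 - \<i> * of_real y) = complex_of_real (1 + y\<^sup>2)"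
    by (simp add: complex_eq_iff power2_eq_square)
  have "(- 1/4 + \<i> * of_real a / 2) * (\<i> / (1 + \<i> * of_real y)) -
         (- 1/4 - \<i> * of_real a / 2) * (\<i> / (1 - \<i> * of_real y)) =
    ((- 1/4 + \<i> * of_real a / 2) * \<i> * (1 - \<i> * of_real y) -
      (- 1/4 - \<i> * of_real a / 2) * \<i> * (1 + \<i> * of_real y)) /
    ((1 + \<i> * of_real y) * (1 - \<i> * of_real y))"
    using common[OF nz] .
  also have "(- 1/4 + \<i> * of_real a / 2) * \<i> * (1 - \<i> * of_real y) -
      (- 1/4 - \<i> * of_real a / 2) * \<i> * (1 + \<i> * of_real y) = complex_of_real (- a - y / 2)"
    by (simp add: complex_eq_iff)
  finally show ?thesis by (simp only: prod of_real_divide)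
qed

lemma norm_half_one_plus_ii:
  "norm ((1 + \<i> * complex_of_real y) / 2) = sqrt (1 + y\<^sup>2) / 2"
  unfolding norm_divide by (simp add: cmod_def)

lemma closed_form_arctan_antiderivative_near:
  assumes I: "open I" "connected I" "\<And>y. y \<in> I \<Longrightarrow> y\<^sup>2 < 3"
    and Y: "antiderivative_on I (arctan_integrand lam) Y"
  shows "hypergeo_closed_form I (\<lambda>y. complex_of_real (Y y))"
proof -
  define a where "a = 3 * lam / 2"
  define w where "w = (\<lambda>y. (1 + \<i> * complex_of_real y) / 2)"
  have w: "w y \<noteq> 0" for y by (auto simp: w_def complex_eq_iff)
  let ?c = "3/4 + \<i> * of_real a / 2 :: complex" and ?\<beta> = "- 1/4 - \<i> * of_real a / 2 :: complex"
  show ?thesis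
  proof (rule closed_form_arctan_antiderivative_unit_disc[OF I(1,2) Y,
        where c = ?c and \<beta> = ?\<beta> and \<epsilon> = 1 and z = w and z' = "\<lambda>_. \<i> / 2"])
    show "?c + 1 \<notin> \<int>\<^sub>\<le>\<^sub>0"
      by (auto simp: complex_eq_iff elim!: nonpos_Ints_cases)
    show "?c \<noteq> 0" by (auto simp: complex_eq_iff)
    show "hypergeo_closed_form I w"
      unfolding w_def by (intro closed_form_intros) auto
    show "(w has_vector_derivative \<i> / 2) (at y)" for y
      unfolding w_def by (auto intro!: derivative_eq_intros)
    show "norm (w y) < 1" if "y \<in> I" for y
    proof -
      have "sqrt (1 + y\<^sup>2) < sqrt (2\<^sup>2)"
        using I(3)[OF that] by (intro real_sqrt_less_mono) simp
      then show ?thesis unfolding w_def norm_half_one_plus_ii by simp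
    qed
    show "(1 * ?c - 1) * (\<i> / 2 / ((1 + \<i> * complex_of_real y) / 2)) - ?\<beta> * (\<i> / 2 / (1 - w y)) =
        of_real ((- (3 * lam / 2) - y / 2) / (1 + y\<^sup>2))" for y
    proof -
      have 1: "1 - w y = (1 - \<i> * of_real y) / 2" by (simp add: w_def field_simps)
      have 2: "1 * ?c - 1 = - 1/4 + \<i> * of_real a / 2" by simp
      have 3: "\<i> / 2 / (v / 2) = \<i> / v" for v :: complex by simp
      show ?thesis
        unfolding 1 2 3 a_def[symmetric] by (rule log_derivative_identity)
    qed
  qed (use w in \<open>auto simp: w_def\<close>)
qed

lemma closed_form_arctan_antiderivative_far:
  assumes I: "open I" "connected I" "\<And>y. y \<in> I \<Longrightarrow> y\<^sup>2 > 3"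
    and Y: "antiderivative_on I (arctan_integrand lam) Y"
  shows "hypergeo_closed_form I (\<lambda>y. complex_of_real (Y y))"
proof -
  define a where "a = 3 * lam / 2"
  define w where "w = (\<lambda>y. (1 + \<i> * complex_of_real y) / 2)"
  have w: "w y \<noteq> 0" for y by (auto simp: w_def complex_eq_iff)
  have w_eq: "(1 + \<i> * complex_of_real y) / 2 = w y" for y by (simp add: w_def)
  let ?\<beta> = "- 1/4 - \<i> * of_real a / 2 :: complex"
  show ?thesis
  proof (rule closed_form_arctan_antiderivative_unit_disc[OF I(1,2) Y,
        where c = "- 1/2" and \<beta> = ?\<beta> and \<epsilon> = "- 1" and z = "\<lambda>y. inverse (w y)"
          and z' = "\<lambda>y. - (\<i> / 2) / (w y)\<^sup>2"])
    show "(- 1/2 + 1 :: complex) \<notin> \<int>\<^sub>\<le>\<^sub>0"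
      by (auto simp: complex_eq_iff elim!: nonpos_Ints_cases)
    have "hypergeo_closed_form I w"
      unfolding w_def by (intro closed_form_intros) auto
    then show "hypergeo_closed_form I (\<lambda>y. inverse (w y))"
      using w by (intro closed_form_intros)
    show "((\<lambda>y. inverse (w y)) has_vector_derivative - (\<i> / 2) / (w y)\<^sup>2) (at y)" for y
    proof -
      have "(w has_vector_derivative \<i> / 2) (at y)"
        unfolding w_def by (auto intro!: derivative_eq_intros)
      from field_vector_diff_chain_at[OF this DERIV_inverse[OF w]]
      show ?thesis by (simp add: o_def field_simps power2_eq_square)
    qed
    show "norm (inverse (w y)) < 1" if "y \<in> I" for y
    proof -
      have "sqrt (2\<^sup>2) < sqrt (1 + y\<^sup>2)"
        using I(3)[OF that] by (intro real_sqrt_less_mono) simp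
      then have "norm (w y) > 1" unfolding w_def norm_half_one_plus_ii by simp
      then show ?thesis unfolding norm_inverse by (rule inverse_less_1_iff[THEN iffD2, OF disjI2])
    qed
    show "- (\<i> / 2) / (w y)\<^sup>2 / inverse (w y) = - 1 * (\<i> / 2 / ((1 + \<i> * complex_of_real y) / 2))"
      for y
      unfolding w_eq using w[of y] by (simp add: field_simps power2_eq_square)
    show "(- 1 * (- 1/2) - 1) * (\<i> / 2 / ((1 + \<i> * complex_of_real y) / 2)) -
        ?\<beta> * (- (\<i> / 2) / (w y)\<^sup>2 / (1 - inverse (w y))) =
        of_real ((- (3 * lam / 2) - y / 2) / (1 + y\<^sup>2))" if "y \<in> I" for y
    proof -
      have w1: "1 - w y \<noteq> 0" by (auto simp: w_def complex_eq_iff)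
      (* partial fractions: the pole at w = 0 shifts the exponent -1/2 of w to - 1/2 - \<beta> = \<alpha> *)
      have pf: "- (\<i> / 2) / (w y)\<^sup>2 / (1 - inverse (w y)) = \<i> / 2 / w y + \<i> / 2 / (1 - w y)"
      proof -
        have "(w y)\<^sup>2 * (1 - inverse (w y)) = - (w y * (1 - w y))"
          using w[of y] by (simp add: field_simps power2_eq_square)
        then have "- (\<i> / 2) / (w y)\<^sup>2 / (1 - inverse (w y)) = \<i> / 2 / (w y * (1 - w y))"
          by (simp only: divide_divide_eq_left minus_divide_divide)
        also have "\<dots> = \<i> / 2 / w y + \<i> / 2 / (1 - w y)"
          using w[of y] w1 by (simp add: field_simps)
        finally show ?thesis .
      qed
      have "(- 1 * (- 1/2) - 1) * (\<i> / 2 / w y) - ?\<beta> * (\<i> / 2 / w y + \<i> / 2 / (1 - w y)) =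
          (- 1/4 + \<i> * of_real a / 2) * (\<i> / 2 / w y) - ?\<beta> * (\<i> / 2 / (1 - w y))"
        by (simp add: algebra_simps)
      also have "\<dots> = (- 1/4 + \<i> * of_real a / 2) * (\<i> / (1 + \<i> * of_real y)) -
          ?\<beta> * (\<i> / (1 - \<i> * of_real y))"
      proof -
        have 1: "1 - w y = (1 - \<i> * of_real y) / 2" by (simp add: w_def field_simps)
        have 3: "\<i> / 2 / (v / 2) = \<i> / v" for v :: complex by simp
        show ?thesis unfolding 1 unfolding w_def 3 ..
      qed
      also have "\<dots> = of_real ((- a - y / 2) / (1 + y\<^sup>2))" by (rule log_derivative_identity)
      finally show ?thesis unfolding pf w_eq a_def .
    qed
  qed (use w in auto)
qed

section \<open>Almost every point\<close>

lemma antiderivative_on_subset: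
  "antiderivative_on D f Y \<Longrightarrow> I \<subseteq> D \<Longrightarrow> antiderivative_on I f Y"
  by (auto simp: antiderivative_on_def)

lemma ae_expressible_exp:
  assumes Y: "antiderivative_on (- {0}) exp_integrand Y"
  shows "ae_hypergeo_expressible c (- {0}) Y"
proof (rule ae_hypergeo_expressibleI[OF Y])
  fix y :: real assume "y \<in> - {0} - {}"
  then consider "y > 0" | "y < 0" by fastforce
  then show "\<exists>I. open I \<and> y \<in> I \<and> I \<subseteq> - {0} \<and>
               hypergeo_closed_form I (\<lambda>y. complex_of_real (Y y))"
  proof cases
    case 1
    have "hypergeo_closed_form {0<..} (\<lambda>y. complex_of_real (Y y))"
      by (rule closed_form_exp_antiderivative[of 1]) (auto intro: antiderivative_on_subset[OF Y])
    then show ?thesis using 1 by (intro exI[of _ "{0<..}"]) auto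
  next
    case 2
    have "hypergeo_closed_form {..<0} (\<lambda>y. complex_of_real (Y y))"
      by (rule closed_form_exp_antiderivative[of "- 1"]) (auto intro: antiderivative_on_subset[OF Y])
    then show ?thesis using 2 by (intro exI[of _ "{..<0}"]) auto
  qed
qed simp

lemma ae_expressible_arctan:
  assumes Y: "antiderivative_on UNIV (arctan_integrand lam) Y"
  shows "ae_hypergeo_expressible c UNIV Y"
proof (rule ae_hypergeo_expressibleI[OF Y])
  fix y :: real assume y: "y \<in> UNIV - {sqrt 3, - sqrt 3}"
  have Y': "antiderivative_on I (arctan_integrand lam) Y" for I
    using antiderivative_on_subset[OF Y] by simp
  have sq: "u\<^sup>2 < 3 \<longleftrightarrow> \<bar>u\<bar> < sqrt 3" "u\<^sup>2 > 3 \<longleftrightarrow> \<bar>u\<bar> > sqrt 3" for u :: real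
    using real_sqrt_less_iff[of "u\<^sup>2" 3] real_sqrt_less_iff[of 3 "u\<^sup>2"] by simp_all
  consider "y \<in> {- sqrt 3<..<sqrt 3}" | "y \<in> {sqrt 3<..}" | "y \<in> {..<- sqrt 3}"
    using y by fastforce
  then show "\<exists>I. open I \<and> y \<in> I \<and> I \<subseteq> UNIV \<and>
               hypergeo_closed_form I (\<lambda>y. complex_of_real (Y y))"
  proof cases
    case 1
    have "hypergeo_closed_form {- sqrt 3<..<sqrt 3} (\<lambda>y. complex_of_real (Y y))"
      by (rule closed_form_arctan_antiderivative_near[OF _ _ _ Y']) (auto simp: sq)
    then show ?thesis using 1 by (intro exI[of _ "{- sqrt 3<..<sqrt 3}"]) auto
  next
    case 2
    have "hypergeo_closed_form {sqrt 3<..} (\<lambda>y. complex_of_real (Y y))"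
      by (rule closed_form_arctan_antiderivative_far[OF _ _ _ Y']) (auto simp: sq)
    then show ?thesis using 2 by (intro exI[of _ "{sqrt 3<..}"]) auto
  next
    case 3
    have "hypergeo_closed_form {..<- sqrt 3} (\<lambda>y. complex_of_real (Y y))"
      by (rule closed_form_arctan_antiderivative_far[OF _ _ _ Y']) (auto simp: sq)
    then show ?thesis using 3 by (intro exI[of _ "{..<- sqrt 3}"]) auto
  qed
qed simp

theorem proposition2:
  shows "(\<forall>(\<kappa>::real) Y. \<kappa> \<noteq> 0 \<and> antiderivative_on (- {0}) exp_integrand Y \<longrightarrow>
           ae_hypergeo_expressible \<kappa> (- {0}) Y) \<and>
         (\<forall>(lam::real) (\<theta>::real) Y. lam > 0 \<and> 0 \<le> \<theta> \<and> \<theta> < 2 * pi \<and>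
           antiderivative_on UNIV (arctan_integrand lam) Y \<longrightarrow>
           ae_hypergeo_expressible (exp (lam * \<theta>)) UNIV Y) \<and>
         (\<forall>(\<kappa>::real) Y. \<kappa> > 0 \<and> antiderivative_on UNIV (arctan_integrand 0) Y \<longrightarrow>
           ae_hypergeo_expressible \<kappa> UNIV Y)"
  using ae_expressible_exp ae_expressible_arctan by blast

end
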